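(* Let $l:\mathbb{R}\times\mathbb{R}\to\mathbb{R}$, $(y,z)\mapsto l(y,z)$, be a convex and Lipschitz function such that $l(y,z)=l(-y,-z)$ for all $(y,z)\in\mathbb{R}\times\mathbb{R}$. Define $$L:=\sup_{(y,z)\in\mathbb{R}\times\mathbb{R}}|\nabla_z l(y,z)|.$$ Let $(X_1,Y_1),\dots,(X_n,Y_n)\in\mathbb{R}^d\times\mathbb{R}$ be the observations, with empirical distribution $P_n$, and let $\mathcal{F}$ be the class of convex and Lipschitz functions $f:\mathbb{R}^d\to\mathbb{R}$. Then, for any $\delta\ge 0$, $$\inf_{f\in\mathcal{F}}\ \sup_{P\in\mathcal{P}(\mathbb{R}^{d+1}):\,D(P,P_n)\le\delta}\mathbb{E}_P\left[l(Y,f(X))\right]=\inf_{f\in\mathcal{F}}\left\{\delta L\,\|\nabla f\|_\infty+\frac1n\sum_{i=1}^n l(Y_i,f(X_i))\right\}.$$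
   Context: $\mathcal{P}(\mathbb{R}^m)$ is the set of Borel probability measures on $\mathbb{R}^m$. Under $P\in\mathcal{P}(\mathbb{R}^{d+1})$, $(X,Y)$ denotes a random vector with law $P$, where $X\in\mathbb{R}^d$ and $Y\in\mathbb{R}$. The empirical distribution is $P_n=\frac1n\sum_{i=1}^n\delta_{(X_i,Y_i)}$. The transport cost $c:\mathbb{R}^{d+1}\times\mathbb{R}^{d+1}\to[0,\infty]$ is $$c((x,y),(x',y'))=\|x-x'\|_1\ \text{ if } y=y',\qquad c((x,y),(x',y'))=+\infty\ \text{ if } y\ne y',$$ and the Wasserstein distance between $\mu,\nu\in\mathcal{P}(\mathbb{R}^{d+1})$ is $$D(\mu,\nu)=\inf\{\mathbb{E}_\pi[c(U,V)]:\pi\in\mathcal{P}(\mathbb{R}^{d+1}\times\mathbb{R}^{d+1}),\ \pi_U=\mu,\ \pi_V=\nu\},$$ where $\pi_U,\pi_V$ are the marginals of $\pi$. For a convex function $f$, $\partial f(x)$ is the subdifferential of $f$ at $x$, and $\|\nabla f\|_\infty:=\sup_{x\in\mathbb{R}^d}\max\{\|g\|_\infty:g\in\partial f(x)\}$. Similarly, $|\nabla_z l(y,z)|:=\max\{|g|:g\in\partial_z l(y,z)\}$, where $\partial_z l(y,z)$ is the partial subdifferential of $l$ in its second argument. *)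

theory Defs
  imports "HOL-Probability.Probability"
begin

definition borel_prob :: "'a::topological_space measure set" where
  "borel_prob = {M. prob_space M \<and> sets M = sets borel}"

definition empirical :: "nat \<Rightarrow> (nat \<Rightarrow> 'a::topological_space) \<Rightarrow> 'a measure" where
  "empirical n Z = measure_of UNIV (sets borel)
     (\<lambda>A. (\<Sum>i=1..n. emeasure (return borel (Z i)) A) / of_nat n)"

lemma sets_empirical [simp, measurable_cong]: "sets (empirical n Z) = sets borel"
  unfolding empirical_def using sets.sigma_sets_eq[of borel]
  by (simp add: sets_measure_of_conv)

lemma space_empirical [simp]: "space (empirical n Z) = UNIV"
  using sets_eq_imp_space_eq[OF sets_empirical] by simp

lemma emeasure_empirical:
  assumes "A \<in> sets borel"
  shows "emeasure (empirical n Z) A = (\<Sum>i=1..n. emeasure (return borel (Z i)) A) / of_nat n"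
proof (rule emeasure_measure_of[OF empirical_def])
  show "sets borel \<subseteq> Pow UNIV" by auto
  show "A \<in> sets (empirical n Z)" using assms by simp
  show "positive (sets (empirical n Z)) (\<lambda>A. (\<Sum>i=1..n. emeasure (return borel (Z i)) A) / of_nat n)"
    by (simp add: positive_def)
  show "countably_additive (sets (empirical n Z))
     (\<lambda>A. (\<Sum>i=1..n. emeasure (return borel (Z i)) A) / of_nat n)"
  proof (rule countably_additiveI)
    fix B :: "nat \<Rightarrow> 'a set"
    assume B: "range B \<subseteq> sets (empirical n Z)" "disjoint_family B"
    have "(\<Sum>k. (\<Sum>i=1..n. emeasure (return borel (Z i)) (B k)) / of_nat n)
        = (\<Sum>k. \<Sum>i=1..n. emeasure (return borel (Z i)) (B k)) / of_nat n"
      by (rule ennreal_suminf_divide)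
    also have "(\<Sum>k. \<Sum>i=1..n. emeasure (return borel (Z i)) (B k))
        = (\<Sum>i=1..n. \<Sum>k. emeasure (return borel (Z i)) (B k))"
      by (rule suminf_sum) simp
    also have "\<dots> = (\<Sum>i=1..n. emeasure (return borel (Z i)) (\<Union>k. B k))"
      using B by (intro sum.cong refl suminf_emeasure) auto
    finally show "(\<Sum>k. (\<Sum>i=1..n. emeasure (return borel (Z i)) (B k)) / of_nat n)
        = (\<Sum>i=1..n. emeasure (return borel (Z i)) (\<Union>k. B k)) / of_nat n" .
  qed
qed

lemma empirical_in_borel_prob:
  assumes "n \<ge> 1"
  shows "empirical n Z \<in> borel_prob"
proof -
  have "emeasure (empirical n Z) UNIV = of_nat n / of_nat n"
    by (simp add: emeasure_empirical)
  also have "\<dots> = (1::ennreal)"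
    using assms by (intro ennreal_divide_self) (auto simp: of_nat_less_top)
  finally show ?thesis
    by (auto simp: borel_prob_def intro!: prob_spaceI)
qed

definition transport_cost :: "(real ^ 'd) \<times> real \<Rightarrow> (real ^ 'd) \<times> real \<Rightarrow> ennreal" where
  "transport_cost u v =
     (if snd u = snd v then ennreal (\<Sum>j\<in>UNIV. \<bar>fst u $ j - fst v $ j\<bar>) else \<infinity>)"

lemma measurable_transport_cost:
  "(\<lambda>w. transport_cost (fst w) (snd w)) \<in> borel_measurable borel"
  unfolding transport_cost_def
proof (rule measurable_If)
  show "(\<lambda>w. ennreal (\<Sum>j\<in>UNIV. \<bar>fst (fst w) $ j - fst (snd w) $ j\<bar>))
      \<in> borel_measurable (borel :: (((real ^ 'd) \<times> real) \<times> (real ^ 'd) \<times> real) measure)"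
    by (intro measurable_compose[OF _ measurable_ennreal] borel_measurable_continuous_onI
        continuous_intros)
  have "closed {w :: ((real ^ 'd) \<times> real) \<times> (real ^ 'd) \<times> real. snd (fst w) = snd (snd w)}"
    by (intro closed_Collect_eq continuous_intros)
  then show "{w \<in> space (borel :: (((real ^ 'd) \<times> real) \<times> (real ^ 'd) \<times> real) measure).
      snd (fst w) = snd (snd w)} \<in> sets borel"
    using borel_closed by simp
qed simp

definition wasserstein :: "((real ^ 'd) \<times> real) measure \<Rightarrow> ((real ^ 'd) \<times> real) measure \<Rightarrow> ennreal" where
  "wasserstein \<mu> \<nu> =
     Inf {\<integral>\<^sup>+ w. transport_cost (fst w) (snd w) \<partial>\<pi> | \<pi>.
            \<pi> \<in> borel_prob \<and> distr \<pi> borel fst = \<mu> \<and> distr \<pi> borel snd = \<nu>}"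

definition lipschitz :: "('a::metric_space \<Rightarrow> 'b::metric_space) \<Rightarrow> bool" where
  "lipschitz f \<longleftrightarrow> (\<exists>C. C-lipschitz_on UNIV f)"

definition subdifferential :: "('a::real_inner \<Rightarrow> real) \<Rightarrow> 'a \<Rightarrow> 'a set" where
  "subdifferential f x = {g. \<forall>y. f x + g \<bullet> (y - x) \<le> f y}"

text \<open>The subdifferential of a real-valued convex function on a Euclidean space is nonempty and
  compact, so the suprema over it below are attained maxima.  The values are extended reals
  in order that no boundedness needs to be presupposed.\<close>

definition grad_supnorm :: "('a::euclidean_space \<Rightarrow> real) \<Rightarrow> ereal" where
  "grad_supnorm f = (SUP x. SUP g\<in>subdifferential f x. ereal (infnorm g))"

definition loss_slope :: "(real \<times> real \<Rightarrow> real) \<Rightarrow> ereal" where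
  "loss_slope l = (SUP (y, z). SUP g\<in>subdifferential (\<lambda>t. l (y, t)) z. ereal \<bar>g\<bar>)"

definition convex_lipschitz :: "('a::euclidean_space \<Rightarrow> real) set" where
  "convex_lipschitz = {f. convex_on UNIV f \<and> lipschitz f}"

end

theory Submission
  imports Defs
begin

text \<open>
  The two sides already agree for each single function \<open>f\<close>.  Write \<open>L\<close> for the slope
  of the loss and \<open>G\<close> for the supremum norm of the gradient of \<open>f\<close>.

  For the upper bound, subgradients show that \<open>f\<close> is \<open>G\<close>-Lipschitz for the 1-norm (the dual of the
  supremum norm in which \<open>G\<close> is measured), and that the loss is \<open>L\<close>-Lipschitz in its second
  argument.  Hence the integrand is \<open>L G\<close>-Lipschitz in \<open>x\<close>.  A coupling of finite cost
  leaves \<open>y\<close> unchanged almost surely, so integrating along it costs at most \<open>L G\<close> times the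
  transport cost (\<open>expectation_le_of_wasserstein\<close>).

  For the lower bound, convexity makes every slope persist at infinity: a subgradient \<open>g\<close> of \<open>f\<close>
  at any point bounds \<open>f\<close> from below by an affine function on the whole space, so \<open>f\<close> grows at
  least at rate \<open>\<parallel>g\<parallel>\<^sub>\<infinity>\<close> along a suitable coordinate direction, from any starting point.  If
  \<open>g \<noteq> 0\<close>, then \<open>f\<close> tends to \<open>+\<infinity>\<close> along that direction, and what matters is how the loss grows in
  its second argument towards \<open>+\<infinity>\<close>.  The symmetry \<open>l (y, z) = l (-y, -z)\<close> turns each negative
  slope of the loss into a positive one, and Lipschitz continuity carries its growth rate from one
  label \<open>y\<close> to every other (\<open>subgradient_growth\<close>).  Moving a mass \<open>q / n\<close> of one data point by
  the distance \<open>n \<delta> / q\<close> uses at most the budget \<open>\<delta>\<close>; as \<open>q\<close> tends to 0, the expected loss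
  rises by \<open>\<delta>\<close> times the growth rate, up to a vanishing error (\<open>worst_case_growth\<close>).  Taking the
  supremum over all pairs of subgradients yields the regulariser (\<open>regulariser_le_of_slopes\<close>).
\<close>

section \<open>Subgradients of convex Lipschitz functions\<close>

abbreviation norm1 :: "'a::euclidean_space \<Rightarrow> real" where
  "norm1 v \<equiv> \<Sum>b\<in>Basis. \<bar>v \<bullet> b\<bar>"

text \<open>The strict epigraph is convex and misses the graph point over \<open>x\<close>.  A separating hyperplane
  cannot be vertical because \<open>f\<close> is finite everywhere, so its slope is a subgradient.\<close>

lemma subdifferential_nonempty:
  fixes f :: "'a::euclidean_space \<Rightarrow> real"
  assumes "convex_on UNIV f"
  shows "subdifferential f x \<noteq> {}"
proof -
  define T where "T = {w :: 'a \<times> real. f (fst w) < snd w}"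
  have "convex T"
  proof (rule convexI)
    fix w w' :: "'a \<times> real" and u v :: real
    assume w: "w \<in> T" "w' \<in> T" and uv: "0 \<le> u" "0 \<le> v" "u + v = 1"
    have "f (u *\<^sub>R fst w + v *\<^sub>R fst w') \<le> u * f (fst w) + v * f (fst w')"
      using assms uv by (auto simp: convex_on_def)
    also have "\<dots> < u * snd w + v * snd w'"
    proof (cases "u = 0")
      case False
      then have "u * f (fst w) < u * snd w"
        using w uv by (intro mult_strict_left_mono) (auto simp: T_def)
      moreover have "v * f (fst w') \<le> v * snd w'"
        using w uv by (intro mult_left_mono) (auto simp: T_def)
      ultimately show ?thesis by linarith
    qed (use w uv in \<open>auto simp: T_def\<close>)
    finally show "u *\<^sub>R w + v *\<^sub>R w' \<in> T" by (simp add: T_def)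
  qed
  moreover have "(0, f 0 + 1) \<in> T" and "(x, f x) \<notin> T"
    by (simp_all add: T_def)
  ultimately have "\<exists>a b. a \<noteq> 0 \<and> (\<forall>w\<in>{(x, f x)}. a \<bullet> w \<le> b) \<and> (\<forall>w\<in>T. b \<le> a \<bullet> w)"
    by (intro separating_hyperplane_sets) auto
  then obtain a b where a: "a \<noteq> 0" "a \<bullet> (x, f x) \<le> b" "\<And>w. w \<in> T \<Longrightarrow> b \<le> a \<bullet> w"
    by (metis singletonI)
  obtain p q where pq: "a = (p, q)" by (cases a)
  have sep: "p \<bullet> x + q * f x \<le> p \<bullet> y + q * t" if "f y < t" for y t
    using a(2) a(3)[of "(y, t)"] that by (simp add: T_def pq)
  \<comment> \<open>\<open>q\<close> is the vertical component of the normal.\<close>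
  have "q \<ge> 0"
    using sep[of x "f x + 1"] by (simp add: algebra_simps)
  moreover have "q \<noteq> 0"
  proof
    assume "q = 0"
    with sep[of "x - p" "f (x - p) + 1"] have "p = 0"
      by (simp add: inner_diff_right inner_commute) (metis inner_ge_zero inner_eq_zero_iff antisym)
    with \<open>q = 0\<close> a(1) pq show False by (simp add: zero_prod_def)
  qed
  ultimately have "q > 0" by simp
  have "f x + (- p /\<^sub>R q) \<bullet> (y - x) \<le> f y" for y
  proof (rule dense_ge)
    fix t assume "f y < t"
    with sep[of y t] \<open>q > 0\<close> show "f x + (- p /\<^sub>R q) \<bullet> (y - x) \<le> t"
      by (simp add: field_simps inner_diff_right)
  qed
  then have "- p /\<^sub>R q \<in> subdifferential f x" 
    unfolding subdifferential_def by blast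
  then show ?thesis by blast
qed

lemma infnorm_subgradient_le:
  fixes f :: "'a::euclidean_space \<Rightarrow> real"
  assumes "C-lipschitz_on UNIV f" and "g \<in> subdifferential f x"
  shows "infnorm g \<le> C"
proof -
  have "norm g * norm g = g \<bullet> g"
    by (simp add: power2_norm_eq_inner[symmetric] power2_eq_square)
  also have "\<dots> \<le> f (x + g) - f x"
    using assms(2) unfolding subdifferential_def by (smt (verit) mem_Collect_eq add_diff_cancel_left')
  also have "\<dots> \<le> C * norm g"
    using lipschitz_onD[OF assms(1), of "x + g" x] by (simp add: dist_norm)
  finally have "norm g \<le> C"
    using lipschitz_on_nonneg[OF assms(1)] by (cases "g = 0") simp_all
  with infnorm_le_norm[of g] show ?thesis by linarith
qed

lemma inner_le_infnorm_norm1: "g \<bullet> v \<le> infnorm g * norm1 v" for g v :: "'a::euclidean_space"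
proof -
  have "g \<bullet> v = (\<Sum>b\<in>Basis. (g \<bullet> b) * (v \<bullet> b))"
    by (rule euclidean_inner)
  also have "\<dots> \<le> (\<Sum>b\<in>Basis. infnorm g * \<bar>v \<bullet> b\<bar>)"
  proof (rule sum_mono)
    fix b :: 'a assume "b \<in> Basis"
    then have "\<bar>g \<bullet> b\<bar> * \<bar>v \<bullet> b\<bar> \<le> infnorm g * \<bar>v \<bullet> b\<bar>"
      by (intro mult_right_mono Basis_le_infnorm) auto
    then show "(g \<bullet> b) * (v \<bullet> b) \<le> infnorm g * \<bar>v \<bullet> b\<bar>"
      by (metis abs_ge_self abs_mult order_trans)
  qed
  finally show ?thesis by (simp add: sum_distrib_left)
qed

text \<open>The maximising direction is a coordinate vector with the sign of the largest entry of \<open>g\<close>.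
  The sign is 0 if \<open>g = 0\<close>, hence only an upper bound for the 1-norm.\<close>

lemma infnorm_attained:
  fixes g :: "'a::euclidean_space"
  obtains v where "norm1 v \<le> 1" and "g \<bullet> v = infnorm g"
proof -
  have "infnorm g \<in> (\<lambda>b. \<bar>g \<bullet> b\<bar>) ` Basis"
    unfolding infnorm_Max by (intro Max_in) auto
  then obtain b where b: "b \<in> Basis" "infnorm g = \<bar>g \<bullet> b\<bar>" by auto
  have "norm1 (sgn (g \<bullet> b) *\<^sub>R b) = \<bar>sgn (g \<bullet> b)\<bar>"
    using b(1) by (simp add: inner_Basis abs_mult if_distrib cong: if_cong)
  then show thesis
    using b by (intro that[of "sgn (g \<bullet> b) *\<^sub>R b"]) (auto simp: abs_sgn_eq sgn_mult_abs abs_sgn)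
qed

text \<open>Every Lipschitz constant bounds the subgradients, so their supremum is a real number \<open>G\<close>;
  conversely the subgradient inequality at \<open>x\<close>, paired by duality of the two norms, makes \<open>G\<close> a
  Lipschitz constant for the 1-norm.\<close>

lemma grad_supnorm_convex_lipschitz:
  fixes f :: "'a::euclidean_space \<Rightarrow> real"
  assumes "f \<in> convex_lipschitz"
  obtains G where "grad_supnorm f = ereal G" and "0 \<le> G"
    and "\<And>x y. f x - f y \<le> G * norm1 (x - y)"
proof -
  obtain C where cvx: "convex_on UNIV f" and C: "C-lipschitz_on UNIV f"
    using assms by (auto simp: convex_lipschitz_def lipschitz_def)
  have ub: "ereal (infnorm g) \<le> grad_supnorm f" if "g \<in> subdifferential f x" for g x
    unfolding grad_supnorm_def using that by (meson SUP_upper UNIV_I order_trans)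
  have "grad_supnorm f \<le> ereal C"
    unfolding grad_supnorm_def by (intro SUP_least) (simp add: infnorm_subgradient_le[OF C])
  moreover obtain g0 where "g0 \<in> subdifferential f 0"
    using subdifferential_nonempty[OF cvx] by blast
  then have nn: "0 \<le> grad_supnorm f"
    using ub[of g0 0] infnorm_pos_le[of g0] by (metis ereal_less_eq(5) order_trans)
  ultimately obtain G where G: "grad_supnorm f = ereal G"
    by (cases "grad_supnorm f") auto
  have "f x - f y \<le> G * norm1 (x - y)" for x y
  proof -
    obtain g where g: "g \<in> subdifferential f x"
      using subdifferential_nonempty[OF cvx] by blast
    then have "f x - f y \<le> g \<bullet> (x - y)"
      by (auto simp: subdifferential_def inner_diff_right dest!: spec[of _ y])
    also have "\<dots> \<le> infnorm g * norm1 (x - y)"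
      by (rule inner_le_infnorm_norm1)
    also have "\<dots> \<le> G * norm1 (x - y)"
      using ub[OF g] G by (intro mult_right_mono) (auto intro: sum_nonneg)
    finally show ?thesis .
  qed
  with that G nn show thesis by auto
qed

lemma loss_slope_eq_grad_supnorm:
  "loss_slope l = (SUP y. grad_supnorm (\<lambda>t. l (y, t)))"
proof -
  have "infnorm g = \<bar>g\<bar>" for g :: real by (simp add: infnorm_Max)
  then have "grad_supnorm (\<lambda>t. l (y, t)) = (SUP z. SUP g\<in>subdifferential (\<lambda>t. l (y, t)) z. ereal \<bar>g\<bar>)" for y
    by (simp add: grad_supnorm_def)
  then show ?thesis
    unfolding loss_slope_def
  proof (intro antisym SUP_least, goal_cases)
    case (1 w)
    obtain y z where w: "w = (y, z)" by (cases w)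
    have "(SUP g\<in>subdifferential (\<lambda>t. l (y, t)) z. ereal \<bar>g\<bar>) \<le> grad_supnorm (\<lambda>t. l (y, t))"
      unfolding 1(1) by (rule SUP_upper) simp
    also have "\<dots> \<le> (SUP y. grad_supnorm (\<lambda>t. l (y, t)))"
      by (rule SUP_upper) simp
    finally show ?case by (simp add: w)
  next
    case (2 y)
    show ?case
      unfolding 2(1) by (rule SUP_least, rule SUP_upper2[of "(y, _)"]) auto
  qed
qed

lemma convex_lipschitz_section:
  fixes l :: "real \<times> real \<Rightarrow> real"
  assumes "convex_on UNIV l" and C: "C-lipschitz_on UNIV l"
  shows "convex_on UNIV (\<lambda>t. l (y, t))" and "C-lipschitz_on UNIV (\<lambda>t. l (y, t))"
proof -
  show "convex_on UNIV (\<lambda>t. l (y, t))"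
  proof (rule convex_onI)
    fix t :: real and z z' :: real
    assume "0 < t" "t < 1"
    then show "l (y, (1 - t) *\<^sub>R z + t *\<^sub>R z') \<le> (1 - t) * l (y, z) + t * l (y, z')"
      using convex_onD[OF assms(1), of t "(y, z)" "(y, z')"] by (simp add: algebra_simps)
  qed simp
  show "C-lipschitz_on UNIV (\<lambda>t. l (y, t))"
  proof (rule lipschitz_onI)
    fix z z'
    show "dist (l (y, z)) (l (y, z')) \<le> C * dist z z'"
      using lipschitz_onD[OF C, of "(y, z)" "(y, z')"] by (simp add: dist_Pair_Pair)
  qed (rule lipschitz_on_nonneg[OF C])
qed

text \<open>The one-dimensional sections of the loss inherit the previous results, since both the supremum
  norm and the 1-norm on the real line are the absolute value.\<close>

lemma loss_slope_convex_lipschitz: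
  fixes l :: "real \<times> real \<Rightarrow> real"
  assumes "convex_on UNIV l" and "lipschitz l"
  obtains L where "loss_slope l = ereal L" and "0 \<le> L"
    and "\<And>y z z'. l (y, z) - l (y, z') \<le> L * \<bar>z - z'\<bar>"
proof -
  obtain C where C: "C-lipschitz_on UNIV l" using assms(2) by (auto simp: lipschitz_def)
  note sec = convex_lipschitz_section[OF assms(1) C]
  have sec_mem: "(\<lambda>t. l (y, t)) \<in> convex_lipschitz" for y
    using sec[of y] by (auto simp: convex_lipschitz_def lipschitz_def)
  have le: "grad_supnorm (\<lambda>t. l (y, t)) \<le> loss_slope l" for y
    unfolding loss_slope_eq_grad_supnorm by (rule SUP_upper) simp
  have "loss_slope l \<le> ereal C"
    unfolding loss_slope_eq_grad_supnorm grad_supnorm_def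
    by (intro SUP_least) (simp add: infnorm_subgradient_le[OF sec(2)])
  moreover have nn: "0 \<le> loss_slope l"
  proof (rule grad_supnorm_convex_lipschitz[OF sec_mem[of 0]])
    fix G assume "grad_supnorm (\<lambda>t. l (0, t)) = ereal G" "0 \<le> G"
    with le[of 0] show ?thesis by (metis ereal_less_eq(5) order_trans)
  qed
  ultimately obtain L where L: "loss_slope l = ereal L"
    by (cases "loss_slope l") auto
  have "l (y, z) - l (y, z') \<le> L * \<bar>z - z'\<bar>" for y z z'
  proof -
    obtain G where G: "grad_supnorm (\<lambda>t. l (y, t)) = ereal G"
      "\<And>z z'. l (y, z) - l (y, z') \<le> G * norm1 (z - z')"
      using grad_supnorm_convex_lipschitz[OF sec_mem[of y]] by metis
    have "l (y, z) - l (y, z') \<le> G * \<bar>z - z'\<bar>"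
      using G(2)[of z z'] by simp
    also have "\<dots> \<le> L * \<bar>z - z'\<bar>"
      using le[of y] G(1) L by (intro mult_right_mono) auto
    finally show ?thesis .
  qed
  with that L nn show thesis by auto
qed

section \<open>Empirical measures and the transport cost\<close>

text \<open>The cost in terms of the basis-free 1-norm, in which the Lipschitz bounds are expressed.\<close>

lemma transport_cost_eq:
  fixes u v :: "(real ^ 'd) \<times> real"
  shows "transport_cost u v = (if snd u = snd v then ennreal (norm1 (fst u - fst v)) else \<infinity>)"
proof -
  have basis: "Basis = range (\<lambda>j. axis j (1::real) :: real ^ 'd)"
    by (auto simp: Basis_vec_def)
  have inj: "inj (\<lambda>j. axis j (1::real) :: real ^ 'd)"
    by (auto simp: inj_on_def axis_eq_axis)
  have "norm1 (fst u - fst v) = (\<Sum>j\<in>UNIV. \<bar>fst u $ j - fst v $ j\<bar>)"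
    unfolding basis by (simp add: sum.reindex[OF inj] inner_axis)
  then show ?thesis by (simp add: transport_cost_def)
qed

text \<open>Drawing a uniform index turns integrals and couplings of empirical measures into finite
  computations.\<close>

lemma empirical_eq_distr_pmf:
  assumes "n \<ge> 1"
  shows "empirical n Z = distr (measure_pmf (pmf_of_set {1..n})) borel Z"
proof (rule measure_eqI)
  fix A assume "A \<in> sets (empirical n Z)"
  then have A: "A \<in> sets borel" by simp
  have "(\<Sum>i=1..n. emeasure (return borel (Z i)) A) = (\<Sum>i=1..n. of_bool (i \<in> Z -` A))"
    using A by (intro sum.cong) (auto simp: indicator_def)
  also have "\<dots> = of_nat (card ({1..n} \<inter> Z -` A))"
    by (simp add: sum.If_cases of_bool_def Int_def)
  finally show "emeasure (empirical n Z) A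
      = emeasure (distr (measure_pmf (pmf_of_set {1..n})) borel Z) A"
    using A assms
    by (simp add: emeasure_empirical emeasure_distr emeasure_pmf_of_set ennreal_of_nat_eq_real_of_nat divide_ennreal)
qed simp

lemma integral_empirical:
  fixes h :: "'a::topological_space \<Rightarrow> real"
  assumes "n \<ge> 1" and h: "h \<in> borel_measurable borel"
  shows "integrable (empirical n Z) h"
    and "(\<integral>z. h z \<partial>empirical n Z) = (1 / real n) * (\<Sum>i=1..n. h (Z i))"
proof -
  have "set_pmf (pmf_of_set {1..n}) = {1..n}" using assms by simp
  then show "integrable (empirical n Z) h"
    using h by (simp add: empirical_eq_distr_pmf[OF assms(1)] integrable_distr_eq
        integrable_measure_pmf_finite)
  show "(\<integral>z. h z \<partial>empirical n Z) = (1 / real n) * (\<Sum>i=1..n. h (Z i))"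
    using assms by (simp add: empirical_eq_distr_pmf[OF assms(1)] integral_distr integral_pmf_of_set)
qed

section \<open>The regularised risk bounds the worst-case risk from above\<close>

text \<open>Finite cost forces both points to share the label \<open>y\<close> almost surely, so the Lipschitz bound in
  \<open>x\<close> applies pointwise and can be integrated.  The same bound makes \<open>h\<close> integrable under the first
  marginal, so that the integral there is not the default value 0.\<close>

lemma expectation_le_of_coupling:
  fixes h :: "(real ^ 'd) \<times> real \<Rightarrow> real"
  assumes h: "h \<in> borel_measurable borel" and "0 \<le> K" and "0 \<le> c"
    and lip: "\<And>x x' y. h (x, y) - h (x', y) \<le> K * norm1 (x - x')"
    and \<pi>: "sets \<pi> = sets borel"
    and cost: "(\<integral>\<^sup>+ w. transport_cost (fst w) (snd w) \<partial>\<pi>) \<le> ennreal c"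
    and int: "integrable (distr \<pi> borel snd) h"
  shows "(\<integral>z. h z \<partial>distr \<pi> borel fst) \<le> (\<integral>z. h z \<partial>distr \<pi> borel snd) + K * c"
proof -
  define d :: "((real ^ 'd) \<times> real) \<times> ((real ^ 'd) \<times> real) \<Rightarrow> real"
    where "d w = norm1 (fst (fst w) - fst (snd w))" for w
  have d_nn: "d w \<ge> 0" for w by (simp add: d_def sum_nonneg)
  note [measurable_cong] = \<pi>
  note [measurable] = h
  have fst_m [measurable]: "fst \<in> measurable \<pi> borel" and snd_m [measurable]: "snd \<in> measurable \<pi> borel"
    unfolding measurable_cong_sets[OF \<pi> refl]
    by (auto intro!: borel_measurable_continuous_onI continuous_intros)
  have d_m [measurable]: "d \<in> borel_measurable \<pi>"
    unfolding measurable_cong_sets[OF \<pi> refl] d_def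
    by (auto intro!: borel_measurable_continuous_onI continuous_intros)
  have cost_m: "(\<lambda>w. transport_cost (fst w) (snd w)) \<in> borel_measurable \<pi>"
    unfolding measurable_cong_sets[OF \<pi> refl] by (rule measurable_transport_cost)
  have "AE w in \<pi>. transport_cost (fst w) (snd w) \<noteq> \<infinity>"
    using cost by (intro nn_integral_PInf_AE cost_m) (auto simp: top_unique)
  then have same: "AE w in \<pi>. snd (fst w) = snd (snd w)"
    by eventually_elim (auto simp: transport_cost_eq split: if_splits)
  have d_le: "(\<integral>\<^sup>+ w. ennreal (d w) \<partial>\<pi>) \<le> ennreal c"
    using cost by (rule order_trans[rotated])
      (auto intro!: nn_integral_mono simp: transport_cost_eq d_def)
  have d_int: "integrable \<pi> d"
    using d_le d_nn by (intro integrableI_nonneg) (auto intro: le_less_trans)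
  have "(\<integral>w. d w \<partial>\<pi>) \<le> c"
    using d_le d_nn \<open>0 \<le> c\<close> d_int by (simp add: nn_integral_eq_integral)
  have snd_int: "integrable \<pi> (\<lambda>w. h (snd w))"
    using int by (simp add: integrable_distr_eq)
  have close: "AE w in \<pi>. \<bar>h (fst w) - h (snd w)\<bar> \<le> K * d w"
    using same
  proof eventually_elim
    case (elim w)
    have "norm1 (fst (snd w) - fst (fst w)) = d w"
      unfolding d_def by (intro sum.cong refl) (simp add: inner_diff_left abs_minus_commute)
    with elim lip[of "fst (fst w)" "snd (fst w)" "fst (snd w)"]
      lip[of "fst (snd w)" "snd (fst w)" "fst (fst w)"]
    show ?case by (cases "fst w"; cases "snd w") (simp add: d_def abs_le_iff)
  qed
  have diff_int: "integrable \<pi> (\<lambda>w. h (fst w) - h (snd w))"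
  proof (rule Bochner_Integration.integrable_bound)
    show "integrable \<pi> (\<lambda>w. K * d w)"
      by (intro integrable_mult_right d_int)
    show "(\<lambda>w. h (fst w) - h (snd w)) \<in> borel_measurable \<pi>"
      by (intro borel_measurable_diff measurable_compose[OF fst_m h] measurable_compose[OF snd_m h])
    show "AE w in \<pi>. norm (h (fst w) - h (snd w)) \<le> norm (K * d w)"
      using close by eventually_elim simp
  qed
  have "(\<integral>w. h (fst w) - h (snd w) \<partial>\<pi>) \<le> (\<integral>w. K * d w \<partial>\<pi>)"
    using close by (intro integral_mono_AE diff_int integrable_mult_right d_int) auto
  also have "\<dots> \<le> K * c"
    using \<open>(\<integral>w. d w \<partial>\<pi>) \<le> c\<close> \<open>0 \<le> K\<close> by (simp add: mult_left_mono)
  finally have "(\<integral>w. h (fst w) - h (snd w) \<partial>\<pi>) \<le> K * c" .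
  moreover have "(\<integral>w. h (fst w) \<partial>\<pi>) = (\<integral>w. h (fst w) - h (snd w) \<partial>\<pi>) + (\<integral>w. h (snd w) \<partial>\<pi>)"
    using Bochner_Integration.integral_add[OF diff_int snd_int] by simp
  ultimately show ?thesis by (simp add: integral_distr)
qed

text \<open>The infimum defining the distance supplies a coupling of cost below \<open>c\<close> for every \<open>c > \<delta>\<close>;
  the bound follows as \<open>c\<close> tends to \<open>\<delta>\<close>.\<close>

lemma expectation_le_of_wasserstein:
  fixes h :: "(real ^ 'd) \<times> real \<Rightarrow> real"
  assumes h: "h \<in> borel_measurable borel" and "0 \<le> K" and "0 \<le> \<delta>"
    and lip: "\<And>x x' y. h (x, y) - h (x', y) \<le> K * norm1 (x - x')"
    and int: "integrable \<nu> h"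
    and W: "wasserstein \<mu> \<nu> \<le> ennreal \<delta>"
  shows "(\<integral>z. h z \<partial>\<mu>) \<le> (\<integral>z. h z \<partial>\<nu>) + K * \<delta>"
proof -
  have bound: "(\<integral>z. h z \<partial>\<mu>) \<le> (\<integral>z. h z \<partial>\<nu>) + K * c" if "\<delta> < c" for c
  proof -
    have "wasserstein \<mu> \<nu> < ennreal c"
      using W that \<open>0 \<le> \<delta>\<close> by (auto intro: le_less_trans simp: ennreal_less_iff)
    then obtain \<pi> where \<pi>: "\<pi> \<in> borel_prob" "distr \<pi> borel fst = \<mu>" "distr \<pi> borel snd = \<nu>"
      and "(\<integral>\<^sup>+ w. transport_cost (fst w) (snd w) \<partial>\<pi>) < ennreal c"
      unfolding wasserstein_def Inf_less_iff by blast
    then show ?thesis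
      using expectation_le_of_coupling[OF h \<open>0 \<le> K\<close> _ lip, of c \<pi>] int that \<open>0 \<le> \<delta>\<close>
      by (auto simp: borel_prob_def)
  qed
  have "((\<lambda>c. (\<integral>z. h z \<partial>\<nu>) + K * c) \<longlongrightarrow> (\<integral>z. h z \<partial>\<nu>) + K * \<delta>) (at_right \<delta>)"
    by (intro tendsto_intros)
  then show ?thesis
    by (rule tendsto_lowerbound) (auto intro!: eventually_at_rightI[of \<delta> "\<delta> + 1"] bound)
qed

section \<open>Moving a small mass far away\<close>

text \<open>The perturbed measure and its coupling come from one draw of an index \<open>i\<close> and an independent
  coin of bias \<open>q\<close>: the first point moves along \<open>v\<close> exactly when \<open>i = 1\<close> and the coin shows
  heads, an event of probability \<open>q / n\<close>.\<close>

lemma perturbed_empirical: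
  fixes X :: "nat \<Rightarrow> real ^ 'd" and Y :: "nat \<Rightarrow> real" and h :: "(real ^ 'd) \<times> real \<Rightarrow> real"
  assumes "n \<ge> 1" and "0 \<le> \<delta>" and q: "0 < q" "q \<le> 1" and v: "norm1 v \<le> 1"
    and h: "h \<in> borel_measurable borel"
  obtains P where "P \<in> borel_prob"
    and "wasserstein P (empirical n (\<lambda>i. (X i, Y i))) \<le> ennreal \<delta>"
    and "(\<integral>z. h z \<partial>P) = (1 / real n) * (\<Sum>i=1..n. h (X i, Y i))
           + q / real n * (h (X 1 + (real n * \<delta> / q) *\<^sub>R v, Y 1) - h (X 1, Y 1))"
proof -
  define p where "p = pair_pmf (pmf_of_set {1..n}) (bernoulli_pmf q)"
  define t where "t = real n * \<delta> / q"
  define V where "V = (\<lambda>(i, b::bool). (X i, Y i))"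
  define U where "U = (\<lambda>(i, b). (if i = (1::nat) \<and> b then X i + t *\<^sub>R v else X i, Y i))"
  define P where "P = distr (measure_pmf p) borel U"
  define \<pi> where "\<pi> = distr (measure_pmf p) borel (\<lambda>w. (U w, V w))"
  have t: "t \<ge> 0" using assms by (simp add: t_def)
  have p_eq: "pmf p (i, b) = (if i \<in> {1..n} then 1 / real n else 0) * (if b then q else 1 - q)" for i b
    using assms by (simp add: p_def pmf_pair)
  have sub: "set_pmf p \<subseteq> {1..n} \<times> UNIV" using assms by (auto simp: p_def)
  have exp_p: "measure_pmf.expectation p k
      = (\<Sum>i=1..n. (1 / real n) * (q * k (i, True) + (1 - q) * k (i, False)))"
    for k :: "nat \<times> bool \<Rightarrow> real"
  proof -
    have "measure_pmf.expectation p k = (\<Sum>w\<in>{1..n} \<times> UNIV. pmf p w * k w)"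
      using sub by (subst integral_measure_pmf[where A = "{1..n} \<times> UNIV"]) auto
    also have "\<dots> = (\<Sum>i=1..n. \<Sum>b\<in>UNIV. pmf p (i, b) * k (i, b))"
      by (simp add: sum.cartesian_product)
    also have "\<dots> = (\<Sum>i=1..n. (1 / real n) * (q * k (i, True) + (1 - q) * k (i, False)))"
      by (intro sum.cong refl) (simp add: p_eq UNIV_bool field_simps)
    finally show ?thesis .
  qed
  have P: "P \<in> borel_prob"
    by (auto simp: P_def borel_prob_def intro!: prob_space.prob_space_distr prob_space_measure_pmf)
  have \<pi>: "\<pi> \<in> borel_prob"
    by (auto simp: \<pi>_def borel_prob_def intro!: prob_space.prob_space_distr prob_space_measure_pmf)
  have fst_m: "fst \<in> measurable borel (borel :: ((real ^ 'd) \<times> real) measure)"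
    and snd_m: "snd \<in> measurable borel (borel :: ((real ^ 'd) \<times> real) measure)"
    by (auto intro!: borel_measurable_continuous_onI continuous_intros)
  have \<pi>_fst: "distr \<pi> borel fst = P"
    unfolding \<pi>_def P_def by (subst distr_distr[OF fst_m]) (auto simp: o_def)
  have "distr \<pi> borel snd = distr (measure_pmf p) borel V"
    unfolding \<pi>_def by (subst distr_distr[OF snd_m]) (auto simp: o_def)
  also have "\<dots> = distr (measure_pmf (map_pmf fst p)) borel (\<lambda>i. (X i, Y i))"
    unfolding map_pmf_rep_eq by (subst distr_distr) (auto simp: o_def V_def split_def)
  also have "\<dots> = empirical n (\<lambda>i. (X i, Y i))"
    by (simp add: p_def map_fst_pair_pmf empirical_eq_distr_pmf[OF assms(1)])
  finally have \<pi>_snd: "distr \<pi> borel snd = empirical n (\<lambda>i. (X i, Y i))" .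
  have "(\<integral>\<^sup>+ w. transport_cost (fst w) (snd w) \<partial>\<pi>) = (\<integral>\<^sup>+ w. transport_cost (U w) (V w) \<partial>p)"
    unfolding \<pi>_def by (subst nn_integral_distr) (auto simp: measurable_transport_cost)
  also have "\<dots> \<le> (\<integral>\<^sup>+ w. ennreal (if w = (1, True) then t else 0) \<partial>p)"
  proof (rule nn_integral_mono)
    fix w :: "nat \<times> bool"
    have "norm1 (t *\<^sub>R v) \<le> t"
      using mult_left_mono[OF v t] t by (simp add: abs_mult sum_distrib_left)
    then show "transport_cost (U w) (V w) \<le> ennreal (if w = (1, True) then t else 0)"
      by (cases w) (auto simp: transport_cost_eq U_def V_def intro!: ennreal_leI)
  qed
  also have "\<dots> = ennreal (measure_pmf.expectation p (\<lambda>w. if w = (1, True) then t else 0))"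
    using t by (intro nn_integral_eq_integral)
      (auto intro!: integrable_measure_pmf_finite finite_subset[OF sub])
  also have "measure_pmf.expectation p (\<lambda>w. if w = (1, True) then t else 0) = \<delta>"
  proof -
    have "measure_pmf.expectation p (\<lambda>w. if w = (1, True) then t else 0)
        = (\<Sum>i=1..n. if i = 1 then (1 / real n) * (q * t) else 0)"
      unfolding exp_p by (intro sum.cong) auto
    also have "\<dots> = \<delta>"
      using assms by (simp add: t_def)
    finally show ?thesis .
  qed
  finally have "(\<integral>\<^sup>+ w. transport_cost (fst w) (snd w) \<partial>\<pi>) \<le> ennreal \<delta>" .
  then have W: "wasserstein P (empirical n (\<lambda>i. (X i, Y i))) \<le> ennreal \<delta>"
    unfolding wasserstein_def using \<pi> \<pi>_fst \<pi>_snd by (blast intro: Inf_lower2)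
  define D where "D = h (X 1 + t *\<^sub>R v, Y 1) - h (X 1, Y 1)"
  have "(\<integral>z. h z \<partial>P) = measure_pmf.expectation p (\<lambda>w. h (U w))"
    unfolding P_def using h by (simp add: integral_distr)
  also have "\<dots> = (\<Sum>i=1..n. (1 / real n) * (h (X i, Y i) + (if i = 1 then q * D else 0)))"
    unfolding exp_p by (intro sum.cong refl) (auto simp: U_def D_def field_simps)
  also have "\<dots> = (1 / real n) * (\<Sum>i=1..n. h (X i, Y i)) + q / real n * D"
    using assms(1) unfolding sum_distrib_left[symmetric] sum.distrib
    by (simp add: distrib_left)
  finally show thesis
    using that[OF P W] by (simp add: D_def t_def)
qed

text \<open>Only the linear growth rate \<open>s\<close> along the ray survives in the limit \<open>q \<rightarrow> 0\<close>: the mass times the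
  distance is always \<open>\<delta>\<close>, whereas the additive constant is multiplied by the vanishing mass.\<close>

lemma worst_case_growth:
  fixes X :: "nat \<Rightarrow> real ^ 'd" and Y :: "nat \<Rightarrow> real" and h :: "(real ^ 'd) \<times> real \<Rightarrow> real"
  assumes "n \<ge> 1" and "0 \<le> \<delta>" and v: "norm1 v \<le> 1"
    and h: "h \<in> borel_measurable borel"
    and growth: "\<And>t. 0 \<le> t \<Longrightarrow> k + s * t \<le> h (X 1 + t *\<^sub>R v, Y 1)"
    and ub: "\<And>P. P \<in> borel_prob \<Longrightarrow> wasserstein P (empirical n (\<lambda>i. (X i, Y i))) \<le> ennreal \<delta>
        \<Longrightarrow> ereal (\<integral>z. h z \<partial>P) \<le> S"
  shows "ereal (\<delta> * s + (1 / real n) * (\<Sum>i=1..n. h (X i, Y i))) \<le> S"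
proof -
  define m where "m = (1 / real n) * (\<Sum>i=1..n. h (X i, Y i))"
  have bound: "ereal (\<delta> * s + m + q * ((k - h (X 1, Y 1)) / real n)) \<le> S" if q: "0 < q" "q \<le> 1" for q
  proof -
    obtain P where P: "P \<in> borel_prob" "wasserstein P (empirical n (\<lambda>i. (X i, Y i))) \<le> ennreal \<delta>"
      "(\<integral>z. h z \<partial>P) = m + q / real n * (h (X 1 + (real n * \<delta> / q) *\<^sub>R v, Y 1) - h (X 1, Y 1))"
      unfolding m_def by (rule perturbed_empirical[OF assms(1,2) q v h])
    have "q / real n * (k + s * (real n * \<delta> / q) - h (X 1, Y 1))
        \<le> q / real n * (h (X 1 + (real n * \<delta> / q) *\<^sub>R v, Y 1) - h (X 1, Y 1))"
      using growth[of "real n * \<delta> / q"] assms q by (intro mult_left_mono) auto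
    moreover have "q / real n * (k + s * (real n * \<delta> / q) - h (X 1, Y 1))
        = \<delta> * s + q * ((k - h (X 1, Y 1)) / real n)"
      using assms(1) q by (simp add: field_simps)
    ultimately have "\<delta> * s + m + q * ((k - h (X 1, Y 1)) / real n) \<le> (\<integral>z. h z \<partial>P)"
      unfolding P(3) by linarith
    with ub[OF P(1,2)] show ?thesis
      by (metis ereal_less_eq(3) order_trans)
  qed
  have "((\<lambda>q. ereal (\<delta> * s + m + q * ((k - h (X 1, Y 1)) / real n))) \<longlongrightarrow>
      ereal (\<delta> * s + m + 0 * ((k - h (X 1, Y 1)) / real n))) (at_right 0)"
    by (intro tendsto_intros)
  then have "ereal (\<delta> * s + m + 0 * ((k - h (X 1, Y 1)) / real n)) \<le> S"
    by (rule tendsto_upperbound[OF _ eventually_at_rightI[of 0 1]]) (use bound in auto)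
  then show ?thesis by (simp add: m_def)
qed

text \<open>The rate depends neither on where the two subgradients were taken nor on the starting point
  \<open>(x, y)\<close>, which only affect the constant \<open>k\<close>.\<close>

lemma subgradient_growth:
  fixes f :: "real ^ 'd \<Rightarrow> real" and l :: "real \<times> real \<Rightarrow> real"
  assumes C: "C-lipschitz_on UNIV l"
    and sym: "\<And>y z. l (y, z) = l (- y, - z)"
    and a: "a \<in> subdifferential (\<lambda>t. l (y0, t)) z0"
    and g: "g \<in> subdifferential f x0" and v: "g \<bullet> v = infnorm g"
  obtains k where "\<And>t. 0 \<le> t \<Longrightarrow> k + \<bar>a\<bar> * infnorm g * t \<le> l (y, f (x + t *\<^sub>R v))"
proof -
  \<comment> \<open>Reflecting the base point by the symmetry of the loss makes the slope nonnegative, which the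
    monotone substitution of the lower bound for \<open>f\<close> needs.\<close>
  obtain y1 z1 where a1: "l (y1, z1) + \<bar>a\<bar> * (z - z1) \<le> l (y1, z)" for z
  proof (cases "a \<ge> 0")
    case True
    with a that[of y0 z0] show ?thesis by (auto simp: subdifferential_def)
  next
    case False
    have "l (- y0, - z0) + \<bar>a\<bar> * (z - (- z0)) \<le> l (- y0, z)" for z
    proof -
      have "l (y0, z0) + a * (- z - z0) \<le> l (y0, - z)"
        using a by (auto simp: subdifferential_def)
      with False show ?thesis
        using sym[of y0 z0] sym[of y0 "- z"] by (simp add: algebra_simps)
    qed
    then show ?thesis by (rule that)
  qed
  define k where "k = l (y1, z1) - \<bar>a\<bar> * z1 - C * \<bar>y1 - y\<bar> + \<bar>a\<bar> * (f x0 + g \<bullet> (x - x0))"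
  show thesis
  proof (rule that[of k])
    fix t :: real
    assume "0 \<le> t"
    let ?z = "f (x + t *\<^sub>R v)"
    have "f x0 + g \<bullet> (x + t *\<^sub>R v - x0) \<le> ?z"
      using g by (auto simp: subdifferential_def)
    then have "f x0 + g \<bullet> (x - x0) + infnorm g * t \<le> ?z"
      using v by (simp add: inner_diff_right inner_add_right algebra_simps)
    then have "\<bar>a\<bar> * (f x0 + g \<bullet> (x - x0) + infnorm g * t) \<le> \<bar>a\<bar> * ?z"
      by (rule mult_left_mono) simp
    moreover have "l (y1, ?z) - l (y, ?z) \<le> C * \<bar>y1 - y\<bar>"
      using lipschitz_onD[OF C, of "(y1, ?z)" "(y, ?z)"]
      by (simp add: dist_Pair_Pair dist_real_def)
    ultimately show "k + \<bar>a\<bar> * infnorm g * t \<le> l (y, ?z)"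
      using a1[of ?z] by (simp add: k_def algebra_simps)
  qed
qed

section \<open>Duality\<close>

text \<open>The product of the two suprema is reached by passing to the supremum over \<open>g\<close> for fixed \<open>a\<close> and
  then over \<open>a\<close>.  A vanishing factor cannot be divided away; there any single pair of subgradients
  gives the claim, and one exists by convexity.\<close>

lemma regulariser_le_of_slopes:
  fixes f :: "real ^ 'd \<Rightarrow> real" and l :: "real \<times> real \<Rightarrow> real"
  assumes f: "f \<in> convex_lipschitz" and l: "convex_on UNIV l" "lipschitz l" and "0 \<le> \<delta>"
    and bound: "\<And>y z a x g. a \<in> subdifferential (\<lambda>t. l (y, t)) z \<Longrightarrow> g \<in> subdifferential f x
        \<Longrightarrow> ereal (\<delta> * (\<bar>a\<bar> * infnorm g) + m) \<le> S"
  shows "ereal \<delta> * loss_slope l * grad_supnorm f + ereal m \<le> S"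
proof -
  obtain G where G: "grad_supnorm f = ereal G" and "0 \<le> G"
    by (rule grad_supnorm_convex_lipschitz[OF f])
  obtain L where L: "loss_slope l = ereal L"
    by (rule loss_slope_convex_lipschitz[OF l])
  obtain C where "C-lipschitz_on UNIV l" using l(2) by (auto simp: lipschitz_def)
  then obtain a0 where a0: "a0 \<in> subdifferential (\<lambda>t. l (0, t)) 0"
    using subdifferential_nonempty[OF convex_lipschitz_section(1)[OF l(1)]] by blast
  obtain g0 where g0: "g0 \<in> subdifferential f 0"
    using f subdifferential_nonempty[of f 0] by (auto simp: convex_lipschitz_def)
  have "\<delta> * L * G \<le> s" if s: "S = ereal (s + m)" for s
  proof -
    have le: "\<delta> * \<bar>a\<bar> * infnorm g \<le> s"
      if "a \<in> subdifferential (\<lambda>t. l (y, t)) z" "g \<in> subdifferential f x" for y z a x g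
      using bound[OF that] s by (simp add: mult.assoc)
    have le_G: "\<delta> * \<bar>a\<bar> * G \<le> s" if a: "a \<in> subdifferential (\<lambda>t. l (y, t)) z" for y z a
    proof (cases "\<delta> * \<bar>a\<bar> = 0")
      case True
      then show ?thesis using le[OF a g0] by (simp only: mult_zero_left)
    next
      case False
      then have pos: "\<delta> * \<bar>a\<bar> > 0" using \<open>0 \<le> \<delta>\<close> by simp
      have "grad_supnorm f \<le> ereal (s / (\<delta> * \<bar>a\<bar>))"
        unfolding grad_supnorm_def
        using le[OF a] pos by (intro SUP_least) (simp add: pos_le_divide_eq mult.commute)
      then show ?thesis using G pos by (simp add: pos_le_divide_eq mult.commute)
    qed
    show ?thesis
    proof (cases "\<delta> * G = 0")
      case True
      then show ?thesis using le_G[OF a0] by (auto simp: mult_ac)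
    next
      case False
      then have pos: "\<delta> * G > 0" using \<open>0 \<le> \<delta>\<close> \<open>0 \<le> G\<close> by simp
      have "\<bar>a\<bar> \<le> s / (\<delta> * G)" if "a \<in> subdifferential (\<lambda>t. l (y, t)) z" for y z a
        using le_G[OF that] pos by (simp add: pos_le_divide_eq mult_ac)
      then have "loss_slope l \<le> ereal (s / (\<delta> * G))"
        unfolding loss_slope_def by (auto intro!: SUP_least)
      then show ?thesis using L pos by (simp add: pos_le_divide_eq mult_ac)
    qed
  qed
  show ?thesis
  proof (cases S)
    case (real r)
    with \<open>\<And>s. S = ereal (s + m) \<Longrightarrow> \<delta> * L * G \<le> s\<close>[of "r - m"] G L show ?thesis by simp
  qed (use bound[OF a0 g0] in auto)
qed

theorem theorem1:
  fixes l :: "real \<times> real \<Rightarrow> real"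
    and X :: "nat \<Rightarrow> real ^ 'd" and Y :: "nat \<Rightarrow> real"
    and n :: nat and \<delta> :: real
  assumes "convex_on UNIV l" and "lipschitz l"
    and "\<And>y z. l (y, z) = l (- y, - z)"
    and "n \<ge> 1" and "\<delta> \<ge> 0"
  shows "(INF f\<in>convex_lipschitz.
            SUP P\<in>{P \<in> borel_prob.
                     wasserstein P (empirical n (\<lambda>i. (X i, Y i))) \<le> ennreal \<delta>}.
              ereal (\<integral>(x, y). l (y, f x) \<partial>P))
       = (INF f\<in>convex_lipschitz.
            ereal \<delta> * loss_slope l * grad_supnorm f
              + ereal ((1 / real n) * (\<Sum>i=1..n. l (Y i, f (X i)))))"
proof (rule INF_cong[OF refl])
  fix f :: "real ^ 'd \<Rightarrow> real"
  assume f: "f \<in> convex_lipschitz"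
  define h where "h = (\<lambda>(x, y). l (y, f x))"
  define m where "m = (1 / real n) * (\<Sum>i=1..n. l (Y i, f (X i)))"
  let ?Pn = "empirical n (\<lambda>i. (X i, Y i))"
  let ?B = "{P \<in> borel_prob. wasserstein P ?Pn \<le> ennreal \<delta>}"
  obtain C where C: "C-lipschitz_on UNIV l" using assms(2) by (auto simp: lipschitz_def)
  obtain G where G: "grad_supnorm f = ereal G" "0 \<le> G" "\<And>x x'. f x - f x' \<le> G * norm1 (x - x')"
    using grad_supnorm_convex_lipschitz[OF f] by blast
  obtain L where L: "loss_slope l = ereal L" "0 \<le> L"
    "\<And>y z z'. l (y, z) - l (y, z') \<le> L * \<bar>z - z'\<bar>"
    using loss_slope_convex_lipschitz[OF assms(1,2)] by blast
  have "continuous_on UNIV l"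
    using C by (rule lipschitz_on_continuous_on)
  moreover have "continuous_on UNIV f"
    using f by (auto simp: convex_lipschitz_def lipschitz_def intro: lipschitz_on_continuous_on)
  ultimately have "continuous_on UNIV h"
    unfolding h_def split_def
    by (auto intro!: continuous_on_compose2[of UNIV l] continuous_on_compose2[of UNIV f] continuous_intros)
  then have h: "h \<in> borel_measurable borel"
    by (rule borel_measurable_continuous_onI)
  have h_lip: "h (x, y) - h (x', y) \<le> (L * G) * norm1 (x - x')" for x x' y
  proof -
    have "norm1 (x' - x) = norm1 (x - x')"
      by (intro sum.cong refl) (simp add: inner_diff_left abs_minus_commute)
    then have "\<bar>f x - f x'\<bar> \<le> G * norm1 (x - x')"
      using G(3)[of x x'] G(3)[of x' x] by (simp add: abs_le_iff)
    then have "L * \<bar>f x - f x'\<bar> \<le> L * (G * norm1 (x - x'))"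
      using L(2) by (rule mult_left_mono)
    with L(3)[of y "f x" "f x'"] show ?thesis by (simp add: h_def mult.assoc)
  qed
  have Pn: "integrable ?Pn h" "(\<integral>z. h z \<partial>?Pn) = m"
    using integral_empirical[OF assms(4) h, of "\<lambda>i. (X i, Y i)"] by (simp_all add: h_def m_def)
  have "(SUP P\<in>?B. ereal (\<integral>z. h z \<partial>P)) = ereal \<delta> * loss_slope l * grad_supnorm f + ereal m"
  proof (rule antisym)
    show "(SUP P\<in>?B. ereal (\<integral>z. h z \<partial>P)) \<le> ereal \<delta> * loss_slope l * grad_supnorm f + ereal m"
    proof (rule SUP_least)
      fix P assume "P \<in> ?B"
      then have "(\<integral>z. h z \<partial>P) \<le> (\<integral>z. h z \<partial>?Pn) + (L * G) * \<delta>"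
        using L(2) G(2) by (intro expectation_le_of_wasserstein[OF h _ assms(5) h_lip Pn(1)]) auto
      then show "ereal (\<integral>z. h z \<partial>P) \<le> ereal \<delta> * loss_slope l * grad_supnorm f + ereal m"
        by (simp add: G(1) L(1) Pn(2) algebra_simps)
    qed
    show "ereal \<delta> * loss_slope l * grad_supnorm f + ereal m \<le> (SUP P\<in>?B. ereal (\<integral>z. h z \<partial>P))"
    proof (rule regulariser_le_of_slopes[OF f assms(1,2,5)])
      fix y z a x g
      assume a: "a \<in> subdifferential (\<lambda>t. l (y, t)) z" and g: "g \<in> subdifferential f x"
      obtain v where v: "norm1 v \<le> 1" "g \<bullet> v = infnorm g" by (rule infnorm_attained)
      obtain k where "\<And>t. 0 \<le> t \<Longrightarrow> k + \<bar>a\<bar> * infnorm g * t \<le> l (Y 1, f (X 1 + t *\<^sub>R v))"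
        using subgradient_growth[OF C assms(3) a g v(2)] by metis
      then have "ereal (\<delta> * (\<bar>a\<bar> * infnorm g) + (1 / real n) * (\<Sum>i=1..n. h (X i, Y i)))
          \<le> (SUP P\<in>?B. ereal (\<integral>z. h z \<partial>P))"
        by (intro worst_case_growth[OF assms(4,5) v(1) h, of k]) (auto simp: h_def intro!: SUP_upper)
      then show "ereal (\<delta> * (\<bar>a\<bar> * infnorm g) + m) \<le> (SUP P\<in>?B. ereal (\<integral>z. h z \<partial>P))"
        by (simp add: h_def m_def)
    qed
  qed
  then show "(SUP P\<in>?B. ereal (\<integral>(x, y). l (y, f x) \<partial>P))
      = ereal \<delta> * loss_slope l * grad_supnorm f + ereal ((1 / real n) * (\<Sum>i=1..n. l (Y i, f (X i))))"
    by (simp add: h_def m_def)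
qed

end
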